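(* Let $\mu,\mu'$ be probability measures on $\mathbb Z$ with supports $S_\mu\subset\mathbb Z^+$ and $S_{\mu'}\subset\mathbb Z^-$. Let $\rho$ be the measure on $\mathbb Z$ defined by $$\rho(n)=\begin{cases}\displaystyle\sum_{k=1}^{+\infty}\mu(k)\,\mu'[n-k+1,n] & \text{if } n\le-1,\\[2mm] \displaystyle\sum_{k=1}^{+\infty}\mu'(-k)\,\mu[n+1,n+k] & \text{if } n\ge0.\end{cases}$$ Then, for any $x_0\in\mathbb Z$, the restriction $\rho_{x_0}$ of $\rho$ to $\mathcal I_{\mathbf C}(r_{x_0})$ is an invariant measure for the crossing sub-process $\mathcal X_{\mathbf C}^{(0)}$ on $\mathcal I_{\mathbf C}(r_{x_0})$.
   Context: $\mathbb Z^+$ (resp. $\mathbb Z^-$) is the set of positive (resp. negative) integers. For a measure $m$ on $\mathbb Z$ and integers $a\le b$, $m[a,b]=\sum_{j=a}^b m(j)$. $D=\max S_\mu$ (possibly $+\infty$), $D'=\min S_{\mu'}$ (possibly $-\infty$), $d=\gcd(S_\mu)$, $d'=\gcd(S_{\mu'})$, $\delta=\gcd(d,d')$; $r_{x}$ is the remainder of $x$ modulo $\delta$, $0\le r_x<\delta$. The oscillating random walk $\mathcal X^{(0)}=(X_n^{(0)})_{n\ge0}$ is the Markov chain on $\mathbb Z$ with $X_{n+1}^{(0)}=X_n^{(0)}+\xi_{n+1}$ if $X_n^{(0)}\le-1$ and $X_{n+1}^{(0)}=X_n^{(0)}+\xi'_{n+1}$ if $X_n^{(0)}\ge0$, where $(\xi_n,\xi_n')_{n\ge1}$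 is i.i.d., $\xi_n$ has law $\mu$ and $\xi'_n$ has law $\mu'$. The crossing times are $C_0=0$ and $C_{k+1}=\inf\{n>C_k: X_n^{(0)}\ge0\}$ if $X_{C_k}^{(0)}\le-1$, $C_{k+1}=\inf\{n>C_k:X_n^{(0)}<0\}$ if $X_{C_k}^{(0)}\ge0$; they are a.s. finite. The crossing sub-process is the Markov chain $\mathcal X^{(0)}_{\mathbf C}=(X_{C_k}^{(0)})_{k\ge0}$. For $0\le r<\delta$, $\mathcal I(r)$ is the irreducible (communicating) class of $r$ for $\mathcal X^{(0)}$, i.e. the set of integers $y\equiv r\pmod\delta$ with $D'\le y\le D-1$; $\mathcal I^+(r)=\{y\in\mathcal I(r):y\ge0\}$, $\mathcal I^-(r)=\{y\in\mathcal I(r):y\le-1\}$; $\mathcal I_{\mathbf C}^+(r)=\{y\in\mathcal I^+(r):(y-S_\mu)\cap\mathcal I^-(r)\neq\emptyset\}$, $\mathcal I_{\mathbf C}^-(r)=\{y\in\mathcal I^-(r):(y-S_{\mu'})\cap\mathcal I^+(r)\neq\emptyset\}$ and $\mathcal I_{\mathbf C}(r)=\mathcal I_{\mathbf C}^+(r)\cup\mathcal I_{\mathbf C}^-(r)$. *)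

theory Defs
  imports "HOL-Probability.Probability" "HOL-Number_Theory.Cong"
begin

text \<open>A path of the oscillating walk; the increments \<open>e\<close>, \<open>e'\<close> are indexed from 1.\<close>

primrec osc_walk :: "(nat \<Rightarrow> int) \<Rightarrow> (nat \<Rightarrow> int) \<Rightarrow> int \<Rightarrow> nat \<Rightarrow> int" where
  "osc_walk e e' x 0 = x"
| "osc_walk e e' x (Suc n) =
     osc_walk e e' x n + (if osc_walk e e' x n \<le> -1 then e (Suc n) else e' (Suc n))"

text \<open>The infimum of the empty set is \<open>\<infinity>\<close> in type \<^typ>\<open>enat\<close>.\<close>

primrec crossing_time :: "(nat \<Rightarrow> int) \<Rightarrow> nat \<Rightarrow> enat" where
  "crossing_time X 0 = 0"
| "crossing_time X (Suc k) =
     (case crossing_time X k of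
        enat m \<Rightarrow> (if X m \<le> -1 then Inf {enat n | n. n > m \<and> X n \<ge> 0}
                   else Inf {enat n | n. n > m \<and> X n < 0})
      | \<infinity> \<Rightarrow> \<infinity>)"

text \<open>The value \<open>None\<close> stands for an infinite crossing time.\<close>

definition crossing_process :: "(nat \<Rightarrow> int) \<Rightarrow> nat \<Rightarrow> int option" where
  "crossing_process X k =
     (case crossing_time X k of enat n \<Rightarrow> Some (X n) | \<infinity> \<Rightarrow> None)"

text \<open>One-step transition kernel of the crossing chain: the law of the position at the
  first crossing time when the walk starts at \<open>x\<close>.\<close>

definition crossing_kernel ::
  "'w measure \<Rightarrow> (nat \<Rightarrow> 'w \<Rightarrow> int) \<Rightarrow> (nat \<Rightarrow> 'w \<Rightarrow> int) \<Rightarrow> int \<Rightarrow> int set \<Rightarrow> ennreal" where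
  "crossing_kernel M \<xi> \<xi>' x A =
     emeasure M {\<omega> \<in> space M.
       crossing_process (osc_walk (\<lambda>n. \<xi> n \<omega>) (\<lambda>n. \<xi>' n \<omega>) x) 1 \<in> Some ` A}"

text \<open>The state space of the chain is \<^term>\<open>space m\<close>; the first clause says that the
  kernel \<open>P\<close> does restrict to a Markov kernel there, the second that \<open>m\<close> has
  finite point masses.\<close>

definition invariant_measure :: "('s \<Rightarrow> 's set \<Rightarrow> ennreal) \<Rightarrow> 's measure \<Rightarrow> bool" where
  "invariant_measure P m \<longleftrightarrow>
     (\<forall>x\<in>space m. P x (space m) = 1) \<and>
     (\<forall>x\<in>space m. emeasure m {x} < \<infinity>) \<and>
     (\<forall>A\<in>sets m. (\<integral>\<^sup>+x. P x A \<partial>m) = emeasure m A)"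

definition seg_mass :: "int pmf \<Rightarrow> int \<Rightarrow> int \<Rightarrow> real" where
  "seg_mass p a b = (\<Sum>j=a..b. pmf p j)"

definition rho_mass :: "int pmf \<Rightarrow> int pmf \<Rightarrow> int \<Rightarrow> ennreal" where
  "rho_mass \<mu> \<mu>' n =
     (if n \<le> -1
      then (\<Sum>\<^sub>\<infinity>k\<in>{1..}. ennreal (pmf \<mu> k * seg_mass \<mu>' (n - k + 1) n))
      else (\<Sum>\<^sub>\<infinity>k\<in>{1..}. ennreal (pmf \<mu>' (- k) * seg_mass \<mu> (n + 1) (n + k))))"

definition rho :: "int pmf \<Rightarrow> int pmf \<Rightarrow> int measure" where
  "rho \<mu> \<mu>' = point_measure UNIV (rho_mass \<mu> \<mu>')"

definition supp_max :: "int pmf \<Rightarrow> ereal" where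
  "supp_max \<mu> = (SUP k\<in>set_pmf \<mu>. ereal (of_int k))"

definition supp_min :: "int pmf \<Rightarrow> ereal" where
  "supp_min \<mu>' = (INF k\<in>set_pmf \<mu>'. ereal (of_int k))"

definition supp_gcd :: "int pmf \<Rightarrow> int pmf \<Rightarrow> int" where
  "supp_gcd \<mu> \<mu>' = gcd (Gcd (set_pmf \<mu>)) (Gcd (set_pmf \<mu>'))"

definition irr_class :: "int pmf \<Rightarrow> int pmf \<Rightarrow> int \<Rightarrow> int set" where
  "irr_class \<mu> \<mu>' r =
     {y. [y = r] (mod supp_gcd \<mu> \<mu>') \<and>
         supp_min \<mu>' \<le> ereal (of_int y) \<and> ereal (of_int y) \<le> supp_max \<mu> - 1}"

definition irr_class_pos :: "int pmf \<Rightarrow> int pmf \<Rightarrow> int \<Rightarrow> int set" where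
  "irr_class_pos \<mu> \<mu>' r = {y \<in> irr_class \<mu> \<mu>' r. y \<ge> 0}"

definition irr_class_neg :: "int pmf \<Rightarrow> int pmf \<Rightarrow> int \<Rightarrow> int set" where
  "irr_class_neg \<mu> \<mu>' r = {y \<in> irr_class \<mu> \<mu>' r. y \<le> -1}"

definition cross_class_pos :: "int pmf \<Rightarrow> int pmf \<Rightarrow> int \<Rightarrow> int set" where
  "cross_class_pos \<mu> \<mu>' r =
     {y \<in> irr_class_pos \<mu> \<mu>' r. (\<lambda>s. y - s) ` set_pmf \<mu> \<inter> irr_class_neg \<mu> \<mu>' r \<noteq> {}}"

definition cross_class_neg :: "int pmf \<Rightarrow> int pmf \<Rightarrow> int \<Rightarrow> int set" where
  "cross_class_neg \<mu> \<mu>' r =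
     {y \<in> irr_class_neg \<mu> \<mu>' r. (\<lambda>s. y - s) ` set_pmf \<mu>' \<inter> irr_class_pos \<mu> \<mu>' r \<noteq> {}}"

definition cross_class :: "int pmf \<Rightarrow> int pmf \<Rightarrow> int \<Rightarrow> int set" where
  "cross_class \<mu> \<mu>' r = cross_class_pos \<mu> \<mu>' r \<union> cross_class_neg \<mu> \<mu>' r"

end

theory Submission
  imports Defs
begin

text \<open>
  From a negative start the walk climbs by i.i.d. positive steps until it crosses, so the crossing
  kernel is an overshoot law: a sum, over the last negative position, of a renewal mass times a
  step probability.  The measure \<open>\<rho>\<close> on the negative side is the convolution of \<open>\<mu>'\<close> with the
  tail of \<open>\<mu>\<close>, and the renewal identity
  \<open>\<Sum>i\<le>m. u i * \<mu>{k. k > m - i} = 1\<close> turns \<open>\<rho>\<close> times the kernel into the convolution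
  of \<open>\<mu>\<close> with the tail of \<open>\<mu>'\<close>, which is \<open>\<rho>\<close> on the non-negative side.  The reflection
  \<open>x \<mapsto> -1 - x\<close> exchanges \<open>\<mu>\<close> and \<open>\<mu>'\<close> and gives the other half.  Finally the crossing class
  is exactly the set of points of the residue class of \<open>x\<^sub>0\<close> charged by \<open>\<rho>\<close>, which the kernel
  cannot leave, by invariance and because every step is divisible by \<open>\<delta>\<close>.
\<close>

subsection \<open>Renewal masses and overshoot\<close>

text \<open>Tonelli for double series: one of the sums is read as an integral over the counting
  measure.\<close>

lemma suminf_swap_ennreal:
  fixes f :: "nat \<Rightarrow> nat \<Rightarrow> ennreal"
  shows "(\<Sum>i. \<Sum>j. f i j) = (\<Sum>j. \<Sum>i. f i j)"
  using nn_integral_suminf[of f "count_space UNIV"] by (simp add: nn_integral_count_space_nat)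

lemma suminf_shift_ennreal:
  fixes f :: "nat \<Rightarrow> ennreal"
  shows "(\<Sum>n. if k \<le> n then f (n - k) else 0) = (\<Sum>n. f n)"
  using suminf_offset[of "\<lambda>n. if k \<le> n then f (n - k) else 0" k] by simp

text \<open>Diagonal \<open>n\<close> collects the pairs with sum \<open>n\<close>. Padding the
  finite inner sums with zeros makes the exchange and the shift of series applicable.\<close>

lemma suminf_triangle_ennreal:
  fixes f :: "nat \<Rightarrow> nat \<Rightarrow> ennreal"
  shows "(\<Sum>n. \<Sum>i\<le>n. f i (n - i)) = (\<Sum>i. \<Sum>j. f i j)"
proof -
  have "(\<Sum>n. \<Sum>i\<le>n. f i (n - i)) = (\<Sum>n. \<Sum>i. if i \<le> n then f i (n - i) else 0)"
  proof (intro arg_cong[where f = suminf] ext)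
    fix n
    show "(\<Sum>i\<le>n. f i (n - i)) = (\<Sum>i. if i \<le> n then f i (n - i) else 0)"
      by (subst suminf_finite[of "{..n}"]) auto
  qed
  also have "\<dots> = (\<Sum>i. \<Sum>n. if i \<le> n then f i (n - i) else 0)"
    by (rule suminf_swap_ennreal)
  also have "\<dots> = (\<Sum>i. \<Sum>j. f i j)"
    by (simp add: suminf_shift_ennreal)
  finally show ?thesis .
qed

text \<open>For a step law \<open>a\<close> on the positive integers: \<open>renewal a n\<close> is the probability that some
  partial sum of the steps equals \<open>n\<close>, and \<open>overshoot a w v\<close> is the probability that the walk
  started at \<open>-1 - w\<close> enters the non-negative integers at \<open>v\<close>.  With \<open>b\<close> the law of minus the
  negative steps, \<open>stat_mass a b w\<close> is the mass of \<open>\<rho>\<close> at \<open>-1 - w\<close>, and the reflection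
  \<open>x \<mapsto> -1 - x\<close> makes \<open>stat_mass b a v\<close> its mass at \<open>v\<close>.\<close>

fun renewal :: "(nat \<Rightarrow> ennreal) \<Rightarrow> nat \<Rightarrow> ennreal" where
  "renewal a n = (if n = 0 then 1 else \<Sum>i<n. renewal a i * a (n - i))"

declare renewal.simps[simp del]

definition tail :: "(nat \<Rightarrow> ennreal) \<Rightarrow> nat \<Rightarrow> ennreal" where
  "tail a m = (\<Sum>k. a (Suc (m + k)))"

definition overshoot :: "(nat \<Rightarrow> ennreal) \<Rightarrow> nat \<Rightarrow> nat \<Rightarrow> ennreal" where
  "overshoot a w v = (\<Sum>i\<le>w. renewal a i * a (Suc (v + (w - i))))"

definition stat_mass :: "(nat \<Rightarrow> ennreal) \<Rightarrow> (nat \<Rightarrow> ennreal) \<Rightarrow> nat \<Rightarrow> ennreal" where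
  "stat_mass a b w = (\<Sum>j. b (Suc (w + j)) * tail a j)"

lemma tail_Suc: "tail a m = a (Suc m) + tail a (Suc m)"
  using suminf_offset[of "\<lambda>k. a (Suc (m + k))" 1] by (simp add: tail_def)

lemma tail_0:
  assumes "a 0 = 0" and "(\<Sum>k. a k) = 1"
  shows "tail a 0 = 1"
  using assms suminf_offset[of a 1] by (simp add: tail_def)

text \<open>A walk with positive steps has exactly one last partial sum \<open>i\<close> not
  exceeding \<open>m\<close>, and its next step is larger than \<open>m - i\<close>; the summands
  are the probabilities of these alternatives.\<close>

lemma sum_renewal_tail:
  assumes "a 0 = 0" and "(\<Sum>k. a k) = 1"
  shows "(\<Sum>i\<le>m. renewal a i * tail a (m - i)) = 1"
proof (induction m)
  case 0
  show ?case using assms by (simp add: tail_0 renewal.simps)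
next
  case (Suc m)
  have r: "renewal a (Suc m) = (\<Sum>i\<le>m. renewal a i * a (Suc m - i))"
    by (subst renewal.simps) (simp add: lessThan_Suc_atMost)
  have "(\<Sum>i\<le>Suc m. renewal a i * tail a (Suc m - i))
      = (\<Sum>i\<le>m. renewal a i * tail a (Suc m - i)) + renewal a (Suc m)"
    using assms by (simp add: tail_0)
  \<comment> \<open>Expanding \<open>renewal a (Suc m)\<close> gives back to each tail the atom it
    lost in passing from \<open>m\<close> to \<open>Suc m\<close>.\<close>
  also have "\<dots> = (\<Sum>i\<le>m. renewal a i * (a (Suc (m - i)) + tail a (Suc (m - i))))"
    unfolding r sum.distrib[symmetric]
    by (intro sum.cong refl) (simp add: distrib_left Suc_diff_le add.commute)
  also have "\<dots> = 1"
    using Suc by (simp add: tail_Suc[symmetric])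
  finally show ?case .
qed

text \<open>Summing over all landing points merges the last steps from position \<open>i\<close>
  into \<open>tail a (w - i)\<close>, so the renewal identity applies.\<close>

lemma suminf_overshoot:
  assumes "a 0 = 0" and "(\<Sum>k. a k) = 1"
  shows "(\<Sum>v. overshoot a w v) = 1"
proof -
  have "(\<Sum>v. overshoot a w v) = (\<Sum>i\<le>w. \<Sum>v. renewal a i * a (Suc (v + (w - i))))"
    unfolding overshoot_def by (rule suminf_sum) simp
  also have "\<dots> = (\<Sum>i\<le>w. renewal a i * tail a (w - i))"
    by (simp add: tail_def add.commute)
  finally show ?thesis using sum_renewal_tail[OF assms] by simp
qed

text \<open>Summation over the last position \<open>-1 - z\<close> before the crossing decouples the two step
  laws; the remaining inner sum collapses by \<open>sum_renewal_tail\<close>.\<close>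

lemma stat_mass_stationary:
  assumes "a 0 = 0" and "(\<Sum>k. a k) = 1"
  shows "(\<Sum>w. stat_mass a b w * overshoot a w v) = stat_mass b a v"
proof -
  \<comment> \<open>The index \<open>w\<close> is written as \<open>i + (w - i)\<close> to expose
    the form \<open>f i (w - i)\<close>; the new variable is \<open>z = w - i\<close>.\<close>
  have "(\<Sum>w. stat_mass a b w * overshoot a w v)
      = (\<Sum>w. \<Sum>i\<le>w. renewal a i * a (Suc (v + (w - i))) * stat_mass a b (i + (w - i)))"
    by (simp add: overshoot_def sum_distrib_left mult.commute)
  also have "\<dots> = (\<Sum>i. \<Sum>z. renewal a i * a (Suc (v + z)) * stat_mass a b (i + z))"
    by (rule suminf_triangle_ennreal)
  also have "\<dots> = (\<Sum>z. \<Sum>i. renewal a i * a (Suc (v + z)) * stat_mass a b (i + z))"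
    by (rule suminf_swap_ennreal)
  also have "\<dots> = (\<Sum>z. a (Suc (v + z)) * tail b z)"
  proof (intro arg_cong[where f = suminf] ext)
    fix z
    have "(\<Sum>i. renewal a i * a (Suc (v + z)) * stat_mass a b (i + z))
        = a (Suc (v + z)) * (\<Sum>i. \<Sum>j. renewal a i * (b (Suc (z + (i + j))) * tail a j))"
      by (simp add: stat_mass_def ac_simps flip: ennreal_suminf_cmult)
    \<comment> \<open>Grouping by \<open>m = i + j\<close> frees the factor \<open>b\<close> from
      \<open>i\<close>.\<close>
    also have "(\<Sum>i. \<Sum>j. renewal a i * (b (Suc (z + (i + j))) * tail a j))
        = (\<Sum>m. \<Sum>i\<le>m. renewal a i * (b (Suc (z + (i + (m - i)))) * tail a (m - i)))"
      by (rule suminf_triangle_ennreal[symmetric])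
    also have "\<dots> = (\<Sum>m. b (Suc (z + m)) * (\<Sum>i\<le>m. renewal a i * tail a (m - i)))"
      by (simp add: sum_distrib_left ac_simps)
    also have "\<dots> = tail b z"
      by (simp add: sum_renewal_tail[OF assms]) (simp add: tail_def)
    finally show "(\<Sum>i. renewal a i * a (Suc (v + z)) * stat_mass a b (i + z))
        = a (Suc (v + z)) * tail b z" .
  qed
  finally show ?thesis by (simp add: stat_mass_def)
qed

text \<open>Offset \<open>j\<close> lies in the window of length \<open>k\<close> exactly when
  \<open>k > j\<close>, so exchanging the sums replaces the window by a tail of \<open>a\<close>.
  This connects the series in \<open>rho_mass\<close> with \<open>stat_mass\<close>.\<close>

lemma suminf_mult_window:
  fixes a b :: "nat \<Rightarrow> ennreal"
  shows "(\<Sum>k. a k * (\<Sum>j<k. b (Suc (w + j)))) = stat_mass a b w"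
proof -
  have "(\<Sum>k. a k * (\<Sum>j<k. b (Suc (w + j))))
      = (\<Sum>k. \<Sum>j. if Suc j \<le> k then a k * b (Suc (w + j)) else 0)"
  proof (intro arg_cong[where f = suminf] ext)
    fix k
    show "a k * (\<Sum>j<k. b (Suc (w + j))) = (\<Sum>j. if Suc j \<le> k then a k * b (Suc (w + j)) else 0)"
      by (subst suminf_finite[of "{..<k}"]) (auto simp: sum_distrib_left)
  qed
  also have "\<dots> = (\<Sum>j. \<Sum>k. if Suc j \<le> k then a k * b (Suc (w + j)) else 0)"
    by (rule suminf_swap_ennreal)
  also have "\<dots> = (\<Sum>j. \<Sum>k. a (Suc (j + k)) * b (Suc (w + j)))"
  proof (rule arg_cong[where f = suminf], rule ext)
    fix j
    show "(\<Sum>k. if Suc j \<le> k then a k * b (Suc (w + j)) else 0)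
        = (\<Sum>k. a (Suc (j + k)) * b (Suc (w + j)))"
      using suminf_offset[of "\<lambda>k. if Suc j \<le> k then a k * b (Suc (w + j)) else 0" "Suc j"]
      by (simp add: ac_simps)
  qed
  also have "\<dots> = stat_mass a b w"
    by (simp add: stat_mass_def tail_def mult.commute)
  finally show ?thesis .
qed

lemma infsum_nat_ennreal:
  fixes f :: "nat \<Rightarrow> ennreal"
  shows "infsum f UNIV = suminf f"
  by (meson has_sum_imp_sums has_sum_infsum nonneg_summable_on_complete sums_unique zero_le)

subsection \<open>First passage of a walk with positive steps\<close>

text \<open>A finite infimum is attained by well-ordering, and the empty set has infimum
  \<infinity>. Hence a finite crossing time is a first occurrence.\<close>

lemma Inf_enat_eq_iff:
  "Inf {enat n | n. P n} = enat n \<longleftrightarrow> P n \<and> (\<forall>m<n. \<not> P m)"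
proof
  assume *: "Inf {enat n | n. P n} = enat n"
  then have "{enat n | n. P n} \<noteq> {}" by (auto simp: Inf_enat_def simp del: Collect_empty_eq)
  then have "enat n \<in> {enat n | n. P n}"
    using * by (metis (no_types, lifting) LeastI_ex Inf_enat_def all_not_in_conv)
  moreover have "\<not> P m" if "m < n" for m
  proof
    assume "P m"
    then have "Inf {enat n | n. P n} \<le> enat m" by (intro Inf_lower) auto
    with * that show False by simp
  qed
  ultimately show "P n \<and> (\<forall>m<n. \<not> P m)" by auto
next
  assume "P n \<and> (\<forall>m<n. \<not> P m)"
  then show "Inf {enat n | n. P n} = enat n"
    by (intro antisym Inf_lower Inf_greatest) (auto simp: not_less[symmetric])
qed

text \<open>One sign-change condition covers both directions of crossing. It is invariant under
  reflection, and measurability can be read off from it.\<close>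

lemma crossing_process_1_eq_Some_iff:
  "crossing_process X 1 = Some y \<longleftrightarrow>
     (\<exists>n>0. X n = y \<and> (y \<le> -1 \<longleftrightarrow> \<not> X 0 \<le> -1) \<and> (\<forall>m<n. X m \<le> -1 \<longleftrightarrow> X 0 \<le> -1))"
proof -
  have *: "crossing_time X 1 = enat n \<longleftrightarrow>
      n > 0 \<and> (X n \<le> -1 \<longleftrightarrow> \<not> X 0 \<le> -1) \<and> (\<forall>m<n. X m \<le> -1 \<longleftrightarrow> X 0 \<le> -1)" for n
  proof (cases "X 0 \<le> -1")
    case True
    then have "crossing_time X 1 = Inf {enat n |n. 0 < n \<and> 0 \<le> X n}"
      by (simp add: enat_0[symmetric])
    then show ?thesis using True by (simp add: Inf_enat_eq_iff) (metis gr0I linorder_not_le zle_diff1_eq diff_0)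
  next
    case False
    then have "crossing_time X 1 = Inf {enat n |n. 0 < n \<and> X n < 0}"
      by (simp add: enat_0[symmetric])
    then show ?thesis using False by (simp add: Inf_enat_eq_iff) (metis gr0I linorder_not_le zle_diff1_eq diff_0)
  qed
  have "crossing_process X 1 = Some y \<longleftrightarrow> (\<exists>n. crossing_time X 1 = enat n \<and> X n = y)"
    unfolding crossing_process_def by (simp split: enat.split)
  then show ?thesis unfolding * by blast
qed

text \<open>The centre of reflection is -1/2 because \<open>0\<close> belongs to the non-negative
  side: \<open>x \<mapsto> -1 - x\<close> exchanges \<open>{..-1}\<close> and
  \<open>{0..}\<close>.\<close>

lemma osc_walk_reflect:
  "osc_walk (\<lambda>n. - e' n) (\<lambda>n. - e n) (-1 - x) n = -1 - osc_walk e e' x n"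
  by (induction n) auto

lemma crossing_process_reflect:
  "crossing_process (osc_walk (\<lambda>n. - e' n) (\<lambda>n. - e n) (-1 - x)) 1 = Some (-1 - y) \<longleftrightarrow>
   crossing_process (osc_walk e e' x) 1 = Some y"
  unfolding crossing_process_1_eq_Some_iff osc_walk_reflect
proof (intro ex_cong1 conj_cong refl)
  fix n
  show "(-1 - y \<le> -1 \<longleftrightarrow> \<not> -1 - osc_walk e e' x 0 \<le> -1) \<longleftrightarrow> (y \<le> -1 \<longleftrightarrow> \<not> osc_walk e e' x 0 \<le> -1)"
    by auto
  show "(\<forall>m<n. (-1 - osc_walk e e' x m \<le> -1) \<longleftrightarrow> (-1 - osc_walk e e' x 0 \<le> -1)) \<longleftrightarrow>
      (\<forall>m<n. (osc_walk e e' x m \<le> -1) \<longleftrightarrow> (osc_walk e e' x 0 \<le> -1))"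
    by (intro all_cong) auto
qed auto

lemma osc_walk_eq_sum:
  assumes "\<And>m. m < n \<Longrightarrow> osc_walk e e' x m \<le> -1"
  shows "osc_walk e e' x n = x + (\<Sum>i=1..n. e i)"
  using assms
proof (induction n)
  case (Suc n)
  then show ?case using Suc.prems[of n] by simp
qed simp

text \<open>Until the crossing only \<open>e\<close> drives the walk. From \<open>-1 - w\<close>, a
  partial sum \<open>s\<close> leads to a negative position iff \<open>s \<le> w\<close>, and to
  \<open>y\<close> iff \<open>s = w + 1 + y\<close>; monotonicity of the partial sums makes the last
  sum below the threshold decisive.\<close>

lemma crossing_from_neg_iff:
  assumes pos: "\<And>i. i \<ge> 1 \<Longrightarrow> e i \<ge> 1"
  shows "crossing_process (osc_walk e e' (-1 - int w)) 1 = Some y \<longleftrightarrow>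
    y \<ge> 0 \<and> (\<exists>n. (\<Sum>i=1..n. nat (e i)) \<le> w \<and> (\<Sum>i=1..Suc n. nat (e i)) = Suc (w + nat y))"
    (is "?L \<longleftrightarrow> ?R")
proof -
  let ?X = "osc_walk e e' (-1 - int w)"
  define S where "S n = (\<Sum>i=1..n. nat (e i))" for n
  have S: "(\<Sum>i=1..n. e i) = int (S n)" for n
    unfolding S_def of_nat_sum using pos by (intro sum.cong) (auto simp: order_trans[OF zero_le_one])
  have mono: "S m \<le> S n" if "m \<le> n" for m n
    unfolding S_def using that by (intro sum_mono2) auto
  have walk: "?X n = -1 - int w + int (S n)" if "\<And>m. m < n \<Longrightarrow> ?X m \<le> -1" for n
    unfolding S[symmetric] using that by (rule osc_walk_eq_sum)
  have "?L \<longleftrightarrow> y \<ge> 0 \<and> (\<exists>n. S n \<le> w \<and> S (Suc n) = Suc (w + nat y))"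
  proof
    assume ?L
    then obtain n where n: "n > 0" "?X n = y" "y \<ge> 0" "\<And>m. m < n \<Longrightarrow> ?X m \<le> -1"
      unfolding crossing_process_1_eq_Some_iff by force
    then obtain k where k: "n = Suc k" by (metis gr0_implies_Suc)
    have "?X k = -1 - int w + int (S k)" "?X n = -1 - int w + int (S n)"
      using n(4) k by (intro walk; simp)+
    with n(2,3) n(4)[of k] k have "S k \<le> w" "S (Suc k) = Suc (w + nat y)"
      by (auto simp del: osc_walk.simps)
    with \<open>y \<ge> 0\<close> show "y \<ge> 0 \<and> (\<exists>n. S n \<le> w \<and> S (Suc n) = Suc (w + nat y))" by blast
  next
    assume "y \<ge> 0 \<and> (\<exists>n. S n \<le> w \<and> S (Suc n) = Suc (w + nat y))"
    then obtain n where n: "y \<ge> 0" "S n \<le> w" "S (Suc n) = Suc (w + nat y)" by blast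
    \<comment> \<open>The formula at \<open>m\<close> needs all earlier positions negative; this
      comes from the formula at earlier times and \<open>S k \<le> S n \<le> w\<close>.\<close>
    have X: "?X m = -1 - int w + int (S m)" if "m \<le> Suc n" for m
      using that
    proof (induction m rule: less_induct)
      case (less m)
      have "?X k \<le> -1" if "k < m" for k
        using less.IH[OF that] less.prems mono[of k n] n that by simp
      then show ?case by (rule walk)
    qed
    show ?L
      unfolding crossing_process_1_eq_Some_iff
    proof (intro exI conjI allI impI)
      show "?X (Suc n) = y" using X[of "Suc n"] n by (simp del: osc_walk.simps)
      fix m assume "m < Suc n"
      then show "?X m \<le> -1 \<longleftrightarrow> ?X 0 \<le> -1"
        using X[of m] mono[of m n] n by simp
    qed (use n in auto)
  qed
  then show ?thesis by (simp only: S_def)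
qed

lemma measurable_partial_sum_count_space:
  fixes \<eta> :: "'i \<Rightarrow> 'b \<Rightarrow> nat"
  assumes "\<And>i. i \<in> I \<Longrightarrow> \<eta> i \<in> N \<rightarrow>\<^sub>M count_space UNIV"
  shows "(\<lambda>\<omega>. \<Sum>i\<in>I. \<eta> i \<omega>) \<in> N \<rightarrow>\<^sub>M count_space UNIV"
proof -
  have eq: "N \<rightarrow>\<^sub>M count_space UNIV = N \<rightarrow>\<^sub>M (borel :: nat measure)"
    by (rule measurable_cong_sets[OF refl]) (simp add: sets_borel_eq_count_space)
  show ?thesis using assms unfolding eq by (rule borel_measurable_sum)
qed

section \<open>Law of the first passage\<close>

context prob_space
begin

text \<open>The two variables are functions of the disjoint index blocks \<open>{1..n}\<close> and
  \<open>{Suc n}\<close> of an independent family.\<close>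

lemma indep_var_partial_sum:
  fixes \<eta> :: "nat \<Rightarrow> 'a \<Rightarrow> nat"
  assumes "indep_vars (\<lambda>_. count_space UNIV) \<eta> {1..}"
  shows "indep_var (count_space UNIV) (\<lambda>\<omega>. \<Sum>i=1..n. \<eta> i \<omega>) (count_space UNIV) (\<eta> (Suc n))"
proof -
  have "indep_var
      (count_space UNIV) ((\<lambda>f. \<Sum>i=1..n. f i) \<circ> (\<lambda>\<omega>. restrict (\<lambda>i. \<eta> i \<omega>) {1..n}))
      (count_space UNIV) ((\<lambda>f. f (Suc n)) \<circ> (\<lambda>\<omega>. restrict (\<lambda>i. \<eta> i \<omega>) {Suc n}))"
    by (intro indep_var_compose[OF indep_var_restrict[OF assms]] measurable_partial_sum_count_space)
       auto
  moreover have "(\<lambda>f. \<Sum>i=1..n. f i) \<circ> (\<lambda>\<omega>. restrict (\<lambda>i. \<eta> i \<omega>) {1..n}) = (\<lambda>\<omega>. \<Sum>i=1..n. \<eta> i \<omega>)"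
    by (auto simp: fun_eq_iff intro!: sum.cong)
  moreover have "(\<lambda>f. f (Suc n)) \<circ> (\<lambda>\<omega>. restrict (\<lambda>i. \<eta> i \<omega>) {Suc n}) = \<eta> (Suc n)"
    by auto
  ultimately show ?thesis by simp
qed

text \<open>The event is split by the number \<open>n\<close> of steps before the passage and the
  value \<open>i\<close> of the partial sum. Independence factors each piece, and summation over
  \<open>n\<close> produces the renewal mass at \<open>i\<close>.\<close>

lemma emeasure_passage:
  fixes \<eta> :: "nat \<Rightarrow> 'a \<Rightarrow> nat"
  assumes indep: "indep_vars (\<lambda>_. count_space UNIV) \<eta> {1..}"
    and law: "\<And>n k. n \<ge> 1 \<Longrightarrow> emeasure M {\<omega> \<in> space M. \<eta> n \<omega> = k} = a k"
    and a0: "a 0 = 0"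
  defines "S \<equiv> \<lambda>n \<omega>. \<Sum>i=1..n. \<eta> i \<omega>"
  shows "emeasure M {\<omega> \<in> space M. \<exists>n. S n \<omega> \<le> w \<and> S (Suc n) \<omega> = Suc (w + v)} = overshoot a w v"
proof -
  have meas_\<eta>: "\<eta> n \<in> M \<rightarrow>\<^sub>M count_space UNIV" if "n \<ge> 1" for n
    using indep that by (auto simp: indep_vars_def)
  have meas_S[measurable]: "S n \<in> M \<rightarrow>\<^sub>M count_space UNIV" for n
    unfolding S_def by (intro measurable_partial_sum_count_space meas_\<eta>) auto
  have [measurable]: "\<eta> (Suc n) \<in> M \<rightarrow>\<^sub>M count_space UNIV" for n
    by (rule meas_\<eta>) simp
  have S_Suc: "S (Suc n) \<omega> = S n \<omega> + \<eta> (Suc n) \<omega>" for n \<omega>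
    by (simp add: S_def)
  define q where "q n i = emeasure M {\<omega> \<in> space M. S n \<omega> = i}" for n i
  have joint: "emeasure M {\<omega> \<in> space M. S n \<omega> = i \<and> \<eta> (Suc n) \<omega> = k} = q n i * a k" for n i k
  proof -
    have "prob ((\<lambda>\<omega>. (S n \<omega>, \<eta> (Suc n) \<omega>)) -` ({i} \<times> {k}) \<inter> space M)
        = prob (S n -` {i} \<inter> space M) * prob (\<eta> (Suc n) -` {k} \<inter> space M)"
      unfolding S_def by (intro indep_varD[OF indep_var_partial_sum[OF indep]]) auto
    moreover have "(\<lambda>\<omega>. (S n \<omega>, \<eta> (Suc n) \<omega>)) -` ({i} \<times> {k}) \<inter> space M
        = {\<omega> \<in> space M. S n \<omega> = i \<and> \<eta> (Suc n) \<omega> = k}"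
      "S n -` {i} \<inter> space M = {\<omega> \<in> space M. S n \<omega> = i}"
      "\<eta> (Suc n) -` {k} \<inter> space M = {\<omega> \<in> space M. \<eta> (Suc n) \<omega> = k}"
      by auto
    ultimately show ?thesis
      by (simp add: q_def emeasure_eq_measure ennreal_mult flip: law[of "Suc n"])
  qed
  \<comment> \<open>The condition \<open>l \<le> m\<close> keeps the natural subtraction
    \<open>m - i\<close> exact.\<close>
  have step: "emeasure M {\<omega> \<in> space M. S n \<omega> \<le> l \<and> S (Suc n) \<omega> = m} = (\<Sum>i\<le>l. q n i * a (m - i))"
    if "l \<le> m" for n l m
  proof -
    have "{\<omega> \<in> space M. S n \<omega> \<le> l \<and> S (Suc n) \<omega> = m}
        = (\<Union>i\<le>l. {\<omega> \<in> space M. S n \<omega> = i \<and> \<eta> (Suc n) \<omega> = m - i})"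
      using that by (auto simp: S_Suc)
    also have "emeasure M \<dots> = (\<Sum>i\<le>l. emeasure M {\<omega> \<in> space M. S n \<omega> = i \<and> \<eta> (Suc n) \<omega> = m - i})"
      by (intro sum_emeasure[symmetric]) (auto simp: disjoint_family_on_def)
    finally show ?thesis by (simp add: joint)
  qed
  \<comment> \<open>Since \<open>a 0 = 0\<close>, the term \<open>j = i\<close> drops out and the
    recursion takes the shape of that of \<open>renewal\<close>.\<close>
  have q_Suc: "q (Suc n) i = (\<Sum>j<i. q n j * a (i - j))" for n i
  proof -
    have "q (Suc n) i = emeasure M {\<omega> \<in> space M. S n \<omega> \<le> i \<and> S (Suc n) \<omega> = i}"
      unfolding q_def by (intro arg_cong[where f = "emeasure M"]) (auto simp: S_Suc)
    also have "\<dots> = (\<Sum>j\<le>i. q n j * a (i - j))"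
      by (rule step) simp
    finally show ?thesis by (simp add: lessThan_Suc_atMost[symmetric] a0)
  qed
  have q_0: "q 0 i = (if i = 0 then 1 else 0)" for i
    using emeasure_space_1 by (simp add: q_def S_def)
  have renewal: "(\<Sum>n. q n i) = renewal a i" for i
  proof (induction i rule: less_induct)
    case (less i)
    have "(\<Sum>n. q n i) = q 0 i + (\<Sum>n. q (Suc n) i)"
      using suminf_offset[of "\<lambda>n. q n i" 1] by simp
    also have "(\<Sum>n. q (Suc n) i) = (\<Sum>j<i. (\<Sum>n. q n j) * a (i - j))"
      unfolding q_Suc by (subst suminf_sum) auto
    also have "\<dots> = (\<Sum>j<i. renewal a j * a (i - j))"
      using less by simp
    finally show ?case by (subst renewal.simps) (simp add: q_0)
  qed
  have mono: "S m \<omega> \<le> S n \<omega>" if "m \<le> n" for m n \<omega>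
    unfolding S_def using that by (intro sum_mono2) auto
  let ?E = "\<lambda>n. {\<omega> \<in> space M. S n \<omega> \<le> w \<and> S (Suc n) \<omega> = Suc (w + v)}"
  \<comment> \<open>On both events \<open>w < S (Suc m) \<le> S n \<le> w\<close> would
    hold.\<close>
  have "?E m \<inter> ?E n = {}" if "m < n" for m n
  proof -
    have "S (Suc m) \<omega> \<le> S n \<omega>" for \<omega> using that by (intro mono) simp
    then show ?thesis by (force dest: order_trans)
  qed
  then have disj: "disjoint_family ?E"
    unfolding disjoint_family_on_def by (metis (no_types, lifting) inf_commute linorder_neqE_nat)
  have "{\<omega> \<in> space M. \<exists>n. S n \<omega> \<le> w \<and> S (Suc n) \<omega> = Suc (w + v)} = (\<Union>n. ?E n)" by auto
  also have "emeasure M \<dots> = (\<Sum>n. emeasure M (?E n))"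
    by (intro suminf_emeasure[symmetric] disj) auto
  also have "\<dots> = (\<Sum>n. \<Sum>i\<le>w. q n i * a (Suc (w + v) - i))"
    by (simp add: step)
  also have "\<dots> = (\<Sum>i\<le>w. (\<Sum>n. q n i) * a (Suc (w + v) - i))"
    by (subst suminf_sum) auto
  also have "\<dots> = overshoot a w v"
    unfolding overshoot_def renewal by (intro sum.cong) (auto simp: Suc_diff_le add.commute)
  finally show ?thesis .
qed

end

subsection \<open>The measure \<open>\<rho>\<close> and the crossing classes\<close>

lemma pmf_map_uminus: "pmf (map_pmf uminus p) k = pmf p (- k)" for p :: "int pmf"
  using pmf_map_inj'[of uminus p "- k"] by simp

lemma map_pmf_uminus_uminus [simp]: "map_pmf uminus (map_pmf uminus p) = p" for p :: "int pmf"
  by (simp add: map_pmf_comp)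

text \<open>Step sizes become naturals, so that both laws fit the renewal lemmas; \<mu>' enters
  through \<open>map_pmf uminus\<close>.\<close>

definition step_mass :: "int pmf \<Rightarrow> nat \<Rightarrow> ennreal" where
  "step_mass p k = ennreal (pmf p (int k))"

lemma step_mass_0: "set_pmf p \<subseteq> {1..} \<Longrightarrow> step_mass p 0 = 0"
  by (force simp: step_mass_def pmf_eq_0_set_pmf)

lemma suminf_step_mass:
  assumes "set_pmf p \<subseteq> {1..}"
  shows "(\<Sum>k. step_mass p k) = 1"
proof -
  have "(\<Sum>k. step_mass p k) = (\<integral>\<^sup>+k. ennreal (pmf p k) \<partial>count_space (range int))"
    unfolding step_mass_def
    by (subst nn_integral_bij_count_space[where g = int and A = UNIV, symmetric])
       (auto simp: step_mass_def nn_integral_count_space_nat bij_betw_def)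
  also have "\<dots> = emeasure (measure_pmf p) (range int)"
    by (rule nn_integral_pmf)
  also have "\<dots> = 1"
    using assms by (intro measure_pmf.emeasure_eq_1_AE)
      (auto simp: AE_measure_pmf_iff image_iff zero_le_imp_eq_int)
  finally show ?thesis .
qed

text \<open>The window is read from its right end \<open>n = -1 - w\<close>: its point
  \<open>n - j\<close> is the step of size \<open>Suc (w + j)\<close> for the reflected
  \<mu>'.\<close>

lemma rho_mass_neg:
  assumes "set_pmf \<mu> \<subseteq> {1..}"
  shows "rho_mass \<mu> \<mu>' (-1 - int w) = stat_mass (step_mass \<mu>) (step_mass (map_pmf uminus \<mu>')) w"
proof -
  let ?n = "-1 - int w"
  have seg: "ennreal (seg_mass \<mu>' (?n - int k + 1) ?n)
      = (\<Sum>j<k. step_mass (map_pmf uminus \<mu>') (Suc (w + j)))" for k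
  proof -
    have "seg_mass \<mu>' (?n - int k + 1) ?n = (\<Sum>j<k. pmf \<mu>' (?n - int j))"
      unfolding seg_mass_def
      by (rule sum.reindex_bij_witness[of _ "\<lambda>j. ?n - int j" "\<lambda>j. nat (?n - j)"]) auto
    also have "ennreal \<dots> = (\<Sum>j<k. ennreal (pmf \<mu>' (?n - int j)))"
      by (rule sum_ennreal[symmetric]) simp
    finally show ?thesis
      by (simp add: step_mass_def pmf_map_uminus algebra_simps)
  qed
  have "rho_mass \<mu> \<mu>' ?n = (\<Sum>\<^sub>\<infinity>k\<in>{1..}. ennreal (pmf \<mu> k * seg_mass \<mu>' (?n - k + 1) ?n))"
    by (simp add: rho_mass_def)
  \<comment> \<open>The only index added is \<open>0\<close>, where \<mu> has no mass.\<close>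
  also have "\<dots> = (\<Sum>\<^sub>\<infinity>k\<in>range int. ennreal (pmf \<mu> k * seg_mass \<mu>' (?n - k + 1) ?n))"
  proof (rule infsum_cong_neutral)
    fix k assume "k \<in> range int - {1..}"
    with assms have "k \<notin> set_pmf \<mu>" by auto
    then show "ennreal (pmf \<mu> k * seg_mass \<mu>' (?n - k + 1) ?n) = 0"
      by (simp add: set_pmf_iff)
  next
    fix k :: int assume "k \<in> {1..} - range int"
    then have "k = int (nat k)" "k \<notin> range int" by auto
    then show "ennreal (pmf \<mu> k * seg_mass \<mu>' (?n - k + 1) ?n) = 0" by blast
  qed simp
  also have "\<dots> = (\<Sum>k. ennreal (pmf \<mu> (int k) * seg_mass \<mu>' (?n - int k + 1) ?n))"
    by (simp add: infsum_reindex infsum_nat_ennreal o_def)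
  also have "\<dots> = (\<Sum>k. step_mass \<mu> k * (\<Sum>j<k. step_mass (map_pmf uminus \<mu>') (Suc (w + j))))"
    unfolding seg[symmetric]
    by (intro arg_cong[where f = suminf] ext) (simp add: step_mass_def seg_mass_def ennreal_mult sum_nonneg)
  also have "\<dots> = stat_mass (step_mass \<mu>) (step_mass (map_pmf uminus \<mu>')) w"
    by (rule suminf_mult_window)
  finally show ?thesis .
qed

text \<open>Negation carries the window \<open>[n + 1, n + k]\<close> to
  \<open>[n' - k + 1, n']\<close> with \<open>n' = -1 - n\<close>, so the two branches are
  exchanged.\<close>

lemma rho_mass_reflect:
  "rho_mass (map_pmf uminus \<mu>') (map_pmf uminus \<mu>) (-1 - n) = rho_mass \<mu> \<mu>' n"
proof -
  have "seg_mass (map_pmf uminus p) a b = seg_mass p (- b) (- a)" for p a b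
    unfolding seg_mass_def
    by (rule sum.reindex_bij_witness[of _ uminus uminus]) (auto simp: pmf_map_uminus)
  then show ?thesis
    unfolding rho_mass_def by (auto simp: pmf_map_uminus intro!: infsum_cong) (simp_all add: algebra_simps)
qed

lemma rho_mass_nonneg:
  assumes "set_pmf \<mu>' \<subseteq> {..-1}"
  shows "rho_mass \<mu> \<mu>' (int v) = stat_mass (step_mass (map_pmf uminus \<mu>')) (step_mass \<mu>) v"
  using rho_mass_neg[of "map_pmf uminus \<mu>'" "map_pmf uminus \<mu>" v] assms
    rho_mass_reflect[of \<mu>' \<mu> "int v"] by force

lemma tail_step_mass_le_1: "set_pmf p \<subseteq> {1..} \<Longrightarrow> tail (step_mass p) m \<le> 1"
proof -
  assume p: "set_pmf p \<subseteq> {1..}"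
  have "tail (step_mass p) m \<le> tail (step_mass p) m + (\<Sum>k<Suc m. step_mass p k)" by simp
  also have "\<dots> = (\<Sum>k. step_mass p k)"
    using suminf_offset[of "step_mass p" "Suc m"] by (simp add: tail_def add.commute)
  finally show ?thesis using suminf_step_mass[OF p] by simp
qed

text \<open>Bounding each tail of \<mu> by 1 leaves a tail of the reflected \<mu>'. The bound serves
  the finiteness clause of \<open>invariant_measure\<close>.\<close>

lemma rho_mass_neg_le_1:
  assumes "set_pmf \<mu> \<subseteq> {1..}" and "set_pmf \<mu>' \<subseteq> {..-1}"
  shows "rho_mass \<mu> \<mu>' (-1 - int w) \<le> 1"
proof -
  let ?b = "step_mass (map_pmf uminus \<mu>')"
  have "stat_mass (step_mass \<mu>) ?b w \<le> (\<Sum>j. ?b (Suc (w + j)) * 1)"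
    unfolding stat_mass_def
    by (intro suminf_le mult_left_mono tail_step_mass_le_1 assms) auto
  also have "\<dots> \<le> 1"
    using tail_step_mass_le_1[of "map_pmf uminus \<mu>'" w] assms by (force simp: tail_def)
  finally show ?thesis using assms by (simp add: rho_mass_neg)
qed

lemma rho_mass_le_1:
  assumes "set_pmf \<mu> \<subseteq> {1..}" and "set_pmf \<mu>' \<subseteq> {..-1}"
  shows "rho_mass \<mu> \<mu>' n \<le> 1"
proof (cases "n \<le> -1")
  case True
  then show ?thesis using rho_mass_neg_le_1[OF assms, of "nat (-1 - n)"] by simp
next
  case False
  have "rho_mass (map_pmf uminus \<mu>') (map_pmf uminus \<mu>) (-1 - int (nat n)) \<le> 1"
    using assms by (intro rho_mass_neg_le_1) force+
  then show ?thesis using False by (simp add: rho_mass_reflect)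
qed

section \<open>Points charged by \<rho>\<close>

lemma stat_mass_eq_0_iff:
  "stat_mass a b w = 0 \<longleftrightarrow> (\<forall>j k. b (Suc (w + j)) = 0 \<or> a (Suc (j + k)) = 0)"
  by (auto simp: stat_mass_def tail_def suminf_eq_zero_iff)

text \<open>A nonzero term of \<open>stat_mass\<close> at offset \<open>i\<close> needs a step
  \<open>j = n - i\<close> of \<mu>' and a step \<open>s > i\<close> of \<mu>. Here
  \<open>i = n - j\<close> is the non-negative point from which the step \<open>j\<close> lands on
  \<open>n\<close>.\<close>

lemma rho_mass_neg_nonzero_iff:
  assumes "set_pmf \<mu> \<subseteq> {1..}" and "n \<le> -1"
  shows "rho_mass \<mu> \<mu>' n \<noteq> 0 \<longleftrightarrow> (\<exists>s\<in>set_pmf \<mu>. \<exists>j\<in>set_pmf \<mu>'. 0 \<le> n - j \<and> n - j < s)"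
proof -
  define w where "w = nat (-1 - n)"
  have n: "n = -1 - int w" using assms by (simp add: w_def)
  have "rho_mass \<mu> \<mu>' n \<noteq> 0 \<longleftrightarrow>
      (\<exists>i k. n - int i \<in> set_pmf \<mu>' \<and> 1 + int i + int k \<in> set_pmf \<mu>)"
  proof -
    have "step_mass (map_pmf uminus \<mu>') (Suc (w + i)) = 0 \<longleftrightarrow> n - int i \<notin> set_pmf \<mu>'" for i
      by (simp add: n step_mass_def pmf_map_uminus set_pmf_iff algebra_simps)
    moreover have "step_mass \<mu> (Suc (i + k)) = 0 \<longleftrightarrow> 1 + int i + int k \<notin> set_pmf \<mu>" for i k
      by (simp add: step_mass_def set_pmf_iff add.assoc)
    ultimately show ?thesis
      by (simp add: n rho_mass_neg[OF assms(1)] stat_mass_eq_0_iff del: of_nat_Suc)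
  qed
  also have "\<dots> \<longleftrightarrow> (\<exists>s\<in>set_pmf \<mu>. \<exists>j\<in>set_pmf \<mu>'. 0 \<le> n - j \<and> n - j < s)"
  proof safe
    fix i k assume "n - int i \<in> set_pmf \<mu>'" "1 + int i + int k \<in> set_pmf \<mu>"
    then show "\<exists>s\<in>set_pmf \<mu>. \<exists>j\<in>set_pmf \<mu>'. 0 \<le> n - j \<and> n - j < s"
      by (intro bexI[of _ "1 + int i + int k"] bexI[of _ "n - int i"]) auto
  next
    fix s j assume "s \<in> set_pmf \<mu>" "j \<in> set_pmf \<mu>'" "0 \<le> n - j" "n - j < s"
    then show "\<exists>i k. n - int i \<in> set_pmf \<mu>' \<and> 1 + int i + int k \<in> set_pmf \<mu>"
      by (intro exI[of _ "nat (n - j)"] exI[of _ "nat (s - 1 - (n - j))"]) auto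
  qed
  finally show ?thesis .
qed

lemma rho_mass_nonneg_nonzero_iff:
  assumes "set_pmf \<mu>' \<subseteq> {..-1}" and "n \<ge> 0"
  shows "rho_mass \<mu> \<mu>' n \<noteq> 0 \<longleftrightarrow> (\<exists>s\<in>set_pmf \<mu>. \<exists>j\<in>set_pmf \<mu>'. j \<le> n - s \<and> n - s < 0)"
proof -
  have "rho_mass (map_pmf uminus \<mu>') (map_pmf uminus \<mu>) (-1 - n) \<noteq> 0 \<longleftrightarrow>
      (\<exists>j\<in>set_pmf \<mu>'. \<exists>s\<in>set_pmf \<mu>. 0 \<le> -1 - n + s \<and> -1 - n + s < - j)"
    using assms by (subst rho_mass_neg_nonzero_iff) force+
  moreover have "0 \<le> -1 - n + s \<and> -1 - n + s < - j \<longleftrightarrow> j \<le> n - s \<and> n - s < 0" for j s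
    by auto
  ultimately show ?thesis by (auto simp: rho_mass_reflect)
qed

text \<open>By discreteness, a support strictly above \<open>y\<close> has infimum at least
  \<open>y + 1\<close>; the value -\<infinity> is covered too.\<close>

lemma supp_min_le_iff: "supp_min p \<le> ereal (of_int y) \<longleftrightarrow> (\<exists>j\<in>set_pmf p. j \<le> y)"
proof
  assume le: "supp_min p \<le> ereal (of_int y)"
  show "\<exists>j\<in>set_pmf p. j \<le> y"
  proof (rule ccontr)
    assume "\<not> (\<exists>j\<in>set_pmf p. j \<le> y)"
    then have "ereal (of_int (y + 1)) \<le> supp_min p"
      unfolding supp_min_def by (intro INF_greatest) auto
    with le have "ereal (of_int (y + 1)) \<le> ereal (of_int y)" by (rule order_trans[rotated])
    then show False by simp
  qed
next
  assume "\<exists>j\<in>set_pmf p. j \<le> y"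
  then show "supp_min p \<le> ereal (of_int y)"
    unfolding supp_min_def by (auto intro: INF_lower2)
qed

lemma le_supp_max_iff: "ereal (of_int y) \<le> supp_max p - 1 \<longleftrightarrow> (\<exists>k\<in>set_pmf p. y < k)"
proof -
  have eq: "ereal (of_int y) \<le> supp_max p - 1 \<longleftrightarrow> ereal (of_int (y + 1)) \<le> supp_max p"
    by (cases "supp_max p") (auto simp: one_ereal_def)
  show ?thesis unfolding eq
  proof
    assume le: "ereal (of_int (y + 1)) \<le> supp_max p"
    show "\<exists>k\<in>set_pmf p. y < k"
    proof (rule ccontr)
      assume "\<not> (\<exists>k\<in>set_pmf p. y < k)"
      then have "supp_max p \<le> ereal (of_int y)"
        unfolding supp_max_def by (intro SUP_least) auto
      with le have "ereal (of_int (y + 1)) \<le> ereal (of_int y)" by (rule order_trans)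
      then show False by simp
    qed
  next
    assume "\<exists>k\<in>set_pmf p. y < k"
    then show "ereal (of_int (y + 1)) \<le> supp_max p"
      unfolding supp_max_def by (force intro: SUP_upper2)
  qed
qed

lemma supp_gcd_dvd: "k \<in> set_pmf \<mu> \<union> set_pmf \<mu>' \<Longrightarrow> supp_gcd \<mu> \<mu>' dvd k"
  unfolding supp_gcd_def by (auto intro: dvd_trans[OF _ Gcd_dvd])

lemma cong_diff_dvd_right:
  fixes d :: int
  assumes "d dvd k"
  shows "[y - k = r] (mod d) \<longleftrightarrow> [y = r] (mod d)"
proof -
  have "y - k - r = (y - r) + - k" by simp
  with assms show ?thesis
    by (simp only: cong_iff_dvd_diff dvd_add_left_iff dvd_minus_iff)
qed

text \<open>Both sides ask for a one-step predecessor of \<open>y\<close> across the origin, within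
  the reach of the opposite law. The other range and residue conditions follow from signs and from
  \<delta> dividing every step.\<close>

lemma cross_class_eq:
  assumes "set_pmf \<mu> \<subseteq> {1..}" and "set_pmf \<mu>' \<subseteq> {..-1}"
  shows "cross_class \<mu> \<mu>' r = {y. [y = r] (mod supp_gcd \<mu> \<mu>') \<and> rho_mass \<mu> \<mu>' y \<noteq> 0}"
proof -
  have irr: "y \<in> irr_class \<mu> \<mu>' r \<longleftrightarrow> [y = r] (mod supp_gcd \<mu> \<mu>') \<and>
      (\<exists>j\<in>set_pmf \<mu>'. j \<le> y) \<and> (\<exists>k\<in>set_pmf \<mu>. y < k)" for y
    by (simp add: irr_class_def supp_min_le_iff le_supp_max_iff)
  \<comment> \<open>Arbitrary support points, used as witnesses for the bounds that hold by sign
    alone.\<close>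
  obtain s\<^sub>0 j\<^sub>0 where s\<^sub>0: "s\<^sub>0 \<in> set_pmf \<mu>" "s\<^sub>0 \<ge> 1" and j\<^sub>0: "j\<^sub>0 \<in> set_pmf \<mu>'" "j\<^sub>0 \<le> -1"
    using assms set_pmf_not_empty[of \<mu>] set_pmf_not_empty[of \<mu>'] by fastforce
  have pos: "y \<in> cross_class_pos \<mu> \<mu>' r \<longleftrightarrow>
      y \<ge> 0 \<and> [y = r] (mod supp_gcd \<mu> \<mu>') \<and> rho_mass \<mu> \<mu>' y \<noteq> 0" for y
  proof (cases "y \<ge> 0")
    case True
    have "y \<in> cross_class_pos \<mu> \<mu>' r \<longleftrightarrow>
        y \<in> irr_class \<mu> \<mu>' r \<and> (\<exists>s\<in>set_pmf \<mu>. y - s \<le> -1 \<and> y - s \<in> irr_class \<mu> \<mu>' r)"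
      using True by (auto simp: cross_class_pos_def irr_class_pos_def irr_class_neg_def)
    also have "\<dots> \<longleftrightarrow> [y = r] (mod supp_gcd \<mu> \<mu>') \<and>
        (\<exists>s\<in>set_pmf \<mu>. y - s \<le> -1 \<and> (\<exists>j\<in>set_pmf \<mu>'. j \<le> y - s))"
      (is "?L \<longleftrightarrow> ?R") unfolding irr
    proof
      assume ?R
      then obtain s j where *: "[y = r] (mod supp_gcd \<mu> \<mu>')" "s \<in> set_pmf \<mu>" "y - s \<le> -1"
        "j \<in> set_pmf \<mu>'" "j \<le> y - s" by blast
      then have "j \<le> y" "y < s" "y - s < s\<^sub>0" "[y - s = r] (mod supp_gcd \<mu> \<mu>')"
        using True s\<^sub>0 by (auto simp: cong_diff_dvd_right supp_gcd_dvd)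
      with * s\<^sub>0 show "([y = r] (mod supp_gcd \<mu> \<mu>') \<and> (\<exists>j\<in>set_pmf \<mu>'. j \<le> y) \<and> (\<exists>k\<in>set_pmf \<mu>. y < k)) \<and>
        (\<exists>s\<in>set_pmf \<mu>. y - s \<le> -1 \<and> [y - s = r] (mod supp_gcd \<mu> \<mu>') \<and>
          (\<exists>j\<in>set_pmf \<mu>'. j \<le> y - s) \<and> (\<exists>k\<in>set_pmf \<mu>. y - s < k))" by blast
    qed blast
    finally show ?thesis
      using True assms by (auto simp: rho_mass_nonneg_nonzero_iff)
  qed (simp add: cross_class_pos_def irr_class_pos_def)
  have neg: "y \<in> cross_class_neg \<mu> \<mu>' r \<longleftrightarrow>
      y \<le> -1 \<and> [y = r] (mod supp_gcd \<mu> \<mu>') \<and> rho_mass \<mu> \<mu>' y \<noteq> 0" for y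
  proof (cases "y \<le> -1")
    case True
    have "y \<in> cross_class_neg \<mu> \<mu>' r \<longleftrightarrow>
        y \<in> irr_class \<mu> \<mu>' r \<and> (\<exists>j\<in>set_pmf \<mu>'. y - j \<ge> 0 \<and> y - j \<in> irr_class \<mu> \<mu>' r)"
      using True by (auto simp: cross_class_neg_def irr_class_pos_def irr_class_neg_def)
    also have "\<dots> \<longleftrightarrow> [y = r] (mod supp_gcd \<mu> \<mu>') \<and>
        (\<exists>j\<in>set_pmf \<mu>'. y - j \<ge> 0 \<and> (\<exists>s\<in>set_pmf \<mu>. y - j < s))"
      (is "?L \<longleftrightarrow> ?R") unfolding irr
    proof
      assume ?R
      then obtain s j where *: "[y = r] (mod supp_gcd \<mu> \<mu>')" "j \<in> set_pmf \<mu>'" "y - j \<ge> 0"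
        "s \<in> set_pmf \<mu>" "y - j < s" by blast
      then have "j \<le> y" "y < s\<^sub>0" "j\<^sub>0 \<le> y - j" "[y - j = r] (mod supp_gcd \<mu> \<mu>')"
        using True s\<^sub>0 j\<^sub>0 by (auto simp: cong_diff_dvd_right supp_gcd_dvd)
      with * s\<^sub>0 j\<^sub>0 show "([y = r] (mod supp_gcd \<mu> \<mu>') \<and> (\<exists>j\<in>set_pmf \<mu>'. j \<le> y) \<and> (\<exists>k\<in>set_pmf \<mu>. y < k)) \<and>
        (\<exists>j\<in>set_pmf \<mu>'. y - j \<ge> 0 \<and> [y - j = r] (mod supp_gcd \<mu> \<mu>') \<and>
          (\<exists>j'\<in>set_pmf \<mu>'. j' \<le> y - j) \<and> (\<exists>k\<in>set_pmf \<mu>. y - j < k))" by blast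
    qed blast
    finally show ?thesis
      using True assms by (auto simp: rho_mass_neg_nonzero_iff)
  qed (simp add: cross_class_neg_def irr_class_neg_def)
  show ?thesis unfolding cross_class_def by (auto simp: pos neg)
qed

subsection \<open>Invariance\<close>

lemma nn_integral_count_space_commute:
  fixes f :: "'a \<Rightarrow> 'b \<Rightarrow> ennreal"
  shows "(\<integral>\<^sup>+x. \<integral>\<^sup>+y. f x y \<partial>count_space UNIV \<partial>count_space UNIV)
       = (\<integral>\<^sup>+y. \<integral>\<^sup>+x. f x y \<partial>count_space UNIV \<partial>count_space UNIV)"
  using nn_integral_fst_count_space[of "case_prod f"] nn_integral_snd_count_space[of "case_prod f"]
  by simp

lemma nn_integral_count_space_int_neg:
  assumes "\<And>x. x \<ge> 0 \<Longrightarrow> f x = (0 :: ennreal)"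
  shows "(\<integral>\<^sup>+x. f x \<partial>count_space UNIV) = (\<Sum>w. f (-1 - int w))"
proof -
  have "(\<integral>\<^sup>+x. f x \<partial>count_space UNIV) = (\<integral>\<^sup>+x. f x \<partial>count_space {..-1})"
    using assms by (intro nn_integral_count_space_eq) auto
  also have "\<dots> = (\<integral>\<^sup>+w. f (-1 - int w) \<partial>count_space UNIV)"
    by (intro nn_integral_bij_count_space[symmetric] bij_betwI[where g = "\<lambda>x. nat (-1 - x)"]) auto
  finally show ?thesis by (simp add: nn_integral_count_space_nat)
qed

lemma nn_integral_count_space_int_nonneg:
  assumes "\<And>x. x < 0 \<Longrightarrow> f x = (0 :: ennreal)"
  shows "(\<integral>\<^sup>+x. f x \<partial>count_space UNIV) = (\<Sum>v. f (int v))"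
proof -
  have "(\<integral>\<^sup>+x. f x \<partial>count_space UNIV) = (\<integral>\<^sup>+x. f x \<partial>count_space {0..})"
    using assms by (intro nn_integral_count_space_eq) auto
  also have "\<dots> = (\<integral>\<^sup>+w. f (int w) \<partial>count_space UNIV)"
    by (intro nn_integral_bij_count_space[symmetric] bij_betwI[where g = nat]) auto
  finally show ?thesis by (simp add: nn_integral_count_space_nat)
qed

lemma nn_integral_count_space_int_reflect:
  "(\<integral>\<^sup>+x. f (-1 - x) \<partial>count_space (UNIV :: int set)) = (\<integral>\<^sup>+x. f x \<partial>count_space UNIV)"
  by (rule nn_integral_bij_count_space) (rule bij_betwI[where g = "\<lambda>x. -1 - x"], auto)

section \<open>Divisibility of displacements\<close>

lemma dvd_of_renewal_nonzero:
  assumes "\<And>k. a k \<noteq> 0 \<Longrightarrow> d dvd k" and "renewal a n \<noteq> 0"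
  shows "d dvd n"
  using assms(2)
proof (induction n rule: less_induct)
  case (less n)
  show ?case
  proof (cases "n = 0")
    case False
    with less.prems have "(\<Sum>i<n. renewal a i * a (n - i)) \<noteq> 0"
      by (subst (asm) renewal.simps) simp
    then obtain i where "i < n" "renewal a i \<noteq> 0" "a (n - i) \<noteq> 0"
      by (auto elim!: sum.not_neutral_contains_not_neutral)
    with less.IH assms(1) have "d dvd i + (n - i)" by (blast intro: dvd_add)
    with \<open>i < n\<close> show ?thesis by simp
  qed simp
qed

text \<open>\<open>Suc (w + v)\<close> is the distance from \<open>-1 - w\<close> to
  \<open>v\<close>: a renewal point \<open>i\<close> plus the last step.\<close>

lemma dvd_of_overshoot_nonzero:
  assumes "\<And>k. a k \<noteq> 0 \<Longrightarrow> d dvd k" and "overshoot a w v \<noteq> 0"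
  shows "d dvd Suc (w + v)"
proof -
  obtain i where "i \<le> w" "renewal a i \<noteq> 0" "a (Suc (v + (w - i))) \<noteq> 0"
    using assms(2) unfolding overshoot_def by (auto elim!: sum.not_neutral_contains_not_neutral)
  then have "d dvd i + Suc (v + (w - i))"
    using assms(1) dvd_of_renewal_nonzero[of a d] by (blast intro: dvd_add)
  with \<open>i \<le> w\<close> show ?thesis by (simp add: add.commute)
qed

section \<open>The crossing kernel\<close>

locale oscillating_increments = prob_space M
  for M :: "'w measure" and \<xi> \<xi>' :: "nat \<Rightarrow> 'w \<Rightarrow> int" and \<mu> \<mu>' :: "int pmf" +
  assumes supp: "set_pmf \<mu> \<subseteq> {1..}" and supp': "set_pmf \<mu>' \<subseteq> {..-1}"
    and indep: "indep_vars (\<lambda>_. count_space UNIV) (\<lambda>n \<omega>. (\<xi> n \<omega>, \<xi>' n \<omega>)) {1..}"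
    and law: "\<And>n. n \<ge> 1 \<Longrightarrow> distr M (count_space UNIV) (\<xi> n) = measure_pmf \<mu>"
    and law': "\<And>n. n \<ge> 1 \<Longrightarrow> distr M (count_space UNIV) (\<xi>' n) = measure_pmf \<mu>'"
begin

abbreviation kernel :: "int \<Rightarrow> int set \<Rightarrow> ennreal" where
  "kernel \<equiv> crossing_kernel M \<xi> \<xi>'"

lemma measurable_pair:
  "n \<ge> 1 \<Longrightarrow> (\<lambda>\<omega>. (\<xi> n \<omega>, \<xi>' n \<omega>)) \<in> M \<rightarrow>\<^sub>M count_space UNIV"
  using indep by (auto simp: indep_vars_def)

lemma measurable_increments:
  assumes "n \<ge> 1"
  shows "\<xi> n \<in> M \<rightarrow>\<^sub>M count_space UNIV" and "\<xi>' n \<in> M \<rightarrow>\<^sub>M count_space UNIV"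
  using measurable_compose[OF measurable_pair[OF assms], of fst "count_space UNIV"]
    measurable_compose[OF measurable_pair[OF assms], of snd "count_space UNIV"] by simp_all

text \<open>A second interpretation of the locale at the reflected data transfers every result on
  negative starting points to non-negative ones.\<close>

lemma reflect:
  "oscillating_increments M (\<lambda>n \<omega>. - \<xi>' n \<omega>) (\<lambda>n \<omega>. - \<xi> n \<omega>)
     (map_pmf uminus \<mu>') (map_pmf uminus \<mu>)"
proof unfold_locales
  show "set_pmf (map_pmf uminus \<mu>') \<subseteq> {1..}" "set_pmf (map_pmf uminus \<mu>) \<subseteq> {..-1}"
    using supp supp' by force+
  show "indep_vars (\<lambda>_. count_space UNIV) (\<lambda>n \<omega>. (- \<xi>' n \<omega>, - \<xi> n \<omega>)) {1..}"
    using indep_vars_compose2[OF indep, of "\<lambda>_ (a, b). (- b, - a)" "\<lambda>_. count_space UNIV"] by simp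
  fix n :: nat assume n: "n \<ge> 1"
  show "distr M (count_space UNIV) (\<lambda>\<omega>. - \<xi>' n \<omega>) = measure_pmf (map_pmf uminus \<mu>')"
    using distr_distr[of uminus "count_space UNIV" "count_space UNIV" "\<xi>' n" M] measurable_increments[OF n]
    by (simp add: map_pmf_rep_eq law'[OF n] o_def)
  show "distr M (count_space UNIV) (\<lambda>\<omega>. - \<xi> n \<omega>) = measure_pmf (map_pmf uminus \<mu>)"
    using distr_distr[of uminus "count_space UNIV" "count_space UNIV" "\<xi> n" M] measurable_increments[OF n]
    by (simp add: map_pmf_rep_eq law[OF n] o_def)
qed

text \<open>The current position takes countably many values, and for each fixed value the next
  position is a function of the increment pair.\<close>

lemma measurable_osc_walk:
  "(\<lambda>\<omega>. osc_walk (\<lambda>n. \<xi> n \<omega>) (\<lambda>n. \<xi>' n \<omega>) x n) \<in> M \<rightarrow>\<^sub>M count_space UNIV"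
proof (induction n)
  case (Suc n)
  have "(\<lambda>\<omega>. (\<lambda>y (a, b). y + (if y \<le> -1 then a else b))
        (osc_walk (\<lambda>n. \<xi> n \<omega>) (\<lambda>n. \<xi>' n \<omega>) x n) (\<xi> (Suc n) \<omega>, \<xi>' (Suc n) \<omega>))
      \<in> M \<rightarrow>\<^sub>M count_space UNIV"
    by (rule measurable_compose_countable[OF measurable_compose[OF measurable_pair] Suc]) auto
  then show ?case by simp
qed simp

lemma sets_crossing_event:
  "{\<omega> \<in> space M. crossing_process (osc_walk (\<lambda>n. \<xi> n \<omega>) (\<lambda>n. \<xi>' n \<omega>) x) 1 = Some y} \<in> sets M"
proof -
  note [measurable] = measurable_osc_walk
  show ?thesis unfolding crossing_process_1_eq_Some_iff by measurable
qed

text \<open>Landing events at distinct points are disjoint and \<open>A\<close> is countable, so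
  point masses determine the kernel.\<close>

lemma kernel_eq_nn_integral: "kernel x A = (\<integral>\<^sup>+y. kernel x {y} \<partial>count_space A)"
proof -
  let ?E = "\<lambda>y. {\<omega> \<in> space M. crossing_process (osc_walk (\<lambda>n. \<xi> n \<omega>) (\<lambda>n. \<xi>' n \<omega>) x) 1 = Some y}"
  have "kernel x A = emeasure M (\<Union>y\<in>A. ?E y)"
    unfolding crossing_kernel_def by (intro arg_cong[where f = "emeasure M"]) auto
  also have "\<dots> = (\<integral>\<^sup>+y. emeasure M (?E y) \<partial>count_space A)"
    by (intro emeasure_UN_countable sets_crossing_event) (auto simp: disjoint_family_on_def)
  finally show ?thesis by (simp add: crossing_kernel_def)
qed

lemma kernel_reflect:
  "crossing_kernel M (\<lambda>n \<omega>. - \<xi>' n \<omega>) (\<lambda>n \<omega>. - \<xi> n \<omega>) (-1 - x) {-1 - y} = kernel x {y}"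
  by (simp add: crossing_kernel_def crossing_process_reflect del: One_nat_def)

lemma AE_increment_pos: "AE \<omega> in M. \<forall>n\<ge>1. \<xi> n \<omega> \<ge> 1"
proof -
  have "AE \<omega> in M. n \<ge> 1 \<longrightarrow> \<xi> n \<omega> \<ge> 1" for n
  proof (cases "n \<ge> 1")
    case True
    have "AE k in distr M (count_space UNIV) (\<xi> n). k \<ge> 1"
      unfolding law[OF True] using supp by (auto simp: AE_measure_pmf_iff)
    then show ?thesis
      using True measurable_increments[OF True] by (subst (asm) AE_distr_iff) auto
  qed simp
  then show ?thesis by (simp add: AE_all_countable)
qed

lemma emeasure_increment:
  assumes "n \<ge> 1"
  shows "emeasure M {\<omega> \<in> space M. nat (\<xi> n \<omega>) = k} = step_mass \<mu> k"
proof -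
  have "emeasure M {\<omega> \<in> space M. nat (\<xi> n \<omega>) = k} = emeasure (measure_pmf \<mu>) {j. nat j = k}"
    unfolding law[OF assms, symmetric] using measurable_increments[OF assms]
    by (subst emeasure_distr) (auto intro!: arg_cong[where f = "emeasure M"])
  \<comment> \<open>\<open>nat\<close> sends all non-positive integers to \<open>0\<close>, but they
    form a null set for \<mu>.\<close>
  also have "\<dots> = emeasure (measure_pmf \<mu>) {int k}"
    using supp by (intro emeasure_eq_AE) (auto simp: AE_measure_pmf_iff)
  finally show ?thesis by (simp add: emeasure_pmf_single step_mass_def)
qed

text \<open>Almost surely all \<xi> are positive, so the pathwise criterion
  \<open>crossing_from_neg_iff\<close> identifies the crossing event with the passage event.\<close>

lemma kernel_neg_start:
  "kernel (-1 - int w) {y} =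
     (if y \<ge> 0 then overshoot (step_mass \<mu>) w (nat y) else 0)"
proof -
  define S where "S n \<omega> = (\<Sum>i=1..n. nat (\<xi> i \<omega>))" for n \<omega>
  note [measurable] = measurable_osc_walk
  have [measurable]: "(\<lambda>\<omega>. nat (\<xi> i \<omega>)) \<in> M \<rightarrow>\<^sub>M count_space UNIV" if "i \<ge> 1" for i
    using measurable_increments[OF that] by simp
  have [measurable]: "S n \<in> M \<rightarrow>\<^sub>M count_space UNIV" for n
    unfolding S_def by (intro measurable_partial_sum_count_space) simp
  have indep_nat: "indep_vars (\<lambda>_. count_space UNIV) (\<lambda>n \<omega>. nat (\<xi> n \<omega>)) {1..}"
    using indep_vars_compose2[OF indep, of "\<lambda>_ (a, b). nat a" "\<lambda>_. count_space UNIV"] by simp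
  have "kernel (-1 - int w) {y} = emeasure M {\<omega> \<in> space M.
      crossing_process (osc_walk (\<lambda>n. \<xi> n \<omega>) (\<lambda>n. \<xi>' n \<omega>) (-1 - int w)) 1 = Some y}"
    by (simp add: crossing_kernel_def)
  also have "\<dots> = emeasure M {\<omega> \<in> space M.
      y \<ge> 0 \<and> (\<exists>n. S n \<omega> \<le> w \<and> S (Suc n) \<omega> = Suc (w + nat y))}"
  proof (rule emeasure_eq_AE)
    show "AE \<omega> in M. \<omega> \<in> {\<omega> \<in> space M.
        crossing_process (osc_walk (\<lambda>n. \<xi> n \<omega>) (\<lambda>n. \<xi>' n \<omega>) (-1 - int w)) 1 = Some y} \<longleftrightarrow>
      \<omega> \<in> {\<omega> \<in> space M. y \<ge> 0 \<and> (\<exists>n. S n \<omega> \<le> w \<and> S (Suc n) \<omega> = Suc (w + nat y))}"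
      using AE_increment_pos
    proof eventually_elim
      case (elim \<omega>)
      then show ?case
        using crossing_from_neg_iff[of "\<lambda>n. \<xi> n \<omega>" "\<lambda>n. \<xi>' n \<omega>" w y] unfolding S_def by blast
    qed
  qed (auto intro: sets_crossing_event simp del: One_nat_def)
  also have "\<dots> = (if y \<ge> 0 then overshoot (step_mass \<mu>) w (nat y) else 0)"
    using emeasure_passage[OF indep_nat emeasure_increment step_mass_0[OF supp], of w "nat y"]
    by (simp add: S_def)
  finally show ?thesis .
qed

text \<open>Full mass expresses that the first crossing time is almost surely finite.\<close>

lemma kernel_neg_total: "x \<le> -1 \<Longrightarrow> kernel x UNIV = 1"
proof -
  assume "x \<le> -1"
  then have x: "x = -1 - int (nat (-1 - x))" by simp
  have "kernel x UNIV = (\<Sum>v. overshoot (step_mass \<mu>) (nat (-1 - x)) v)"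
    by (subst x, subst kernel_eq_nn_integral, subst nn_integral_count_space_int_nonneg)
       (simp_all only: kernel_neg_start, simp_all)
  then show ?thesis
    using suminf_overshoot[OF step_mass_0[OF supp] suminf_step_mass[OF supp]] by simp
qed

lemma kernel_neg_dvd:
  assumes "x \<le> -1" and "\<And>k. k \<in> set_pmf \<mu> \<Longrightarrow> d dvd k" and "kernel x {y} \<noteq> 0"
  shows "d dvd y - x"
proof -
  define w where "w = nat (-1 - x)"
  have x: "x = -1 - int w" using assms by (simp add: w_def)
  have "y \<ge> 0" and nz: "overshoot (step_mass \<mu>) w (nat y) \<noteq> 0"
    using assms(3) unfolding x kernel_neg_start by (auto split: if_splits)
  have "nat \<bar>d\<bar> dvd k" if "step_mass \<mu> k \<noteq> 0" for k
    using that assms(2)[of "int k"] by (auto simp: step_mass_def set_pmf_iff)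
  from dvd_of_overshoot_nonzero[OF this nz] have "d dvd int (Suc (w + nat y))"
    unfolding nat_abs_dvd_iff .
  then show ?thesis using \<open>y \<ge> 0\<close> by (simp add: x algebra_simps)
qed

lemma kernel_pos_start:
  assumes "x \<ge> 0"
  shows "kernel x {y} =
    (if y \<le> -1 then overshoot (step_mass (map_pmf uminus \<mu>')) (nat x) (nat (-1 - y)) else 0)"
proof -
  interpret R: oscillating_increments M "\<lambda>n \<omega>. - \<xi>' n \<omega>" "\<lambda>n \<omega>. - \<xi> n \<omega>"
    "map_pmf uminus \<mu>'" "map_pmf uminus \<mu>"
    by (rule reflect)
  show ?thesis
    using R.kernel_neg_start[of "nat x" "-1 - y"] assms kernel_reflect[of x y] by simp
qed

text \<open>Only negative points cross to \<open>y \<ge> 0\<close>, so the integral is the series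
  over \<open>w\<close> evaluated by \<open>stat_mass_stationary\<close>.\<close>

lemma stationary_nonneg:
  assumes "y \<ge> 0"
  shows "(\<integral>\<^sup>+x. rho_mass \<mu> \<mu>' x * kernel x {y} \<partial>count_space UNIV) = rho_mass \<mu> \<mu>' y"
proof -
  let ?a = "step_mass \<mu>" and ?b = "step_mass (map_pmf uminus \<mu>')"
  have "(\<integral>\<^sup>+x. rho_mass \<mu> \<mu>' x * kernel x {y} \<partial>count_space UNIV)
      = (\<Sum>w. rho_mass \<mu> \<mu>' (-1 - int w) * kernel (-1 - int w) {y})"
    using assms by (intro nn_integral_count_space_int_neg) (simp add: kernel_pos_start)
  also have "\<dots> = (\<Sum>w. stat_mass ?a ?b w * overshoot ?a w (nat y))"
    using assms unfolding kernel_neg_start by (simp add: rho_mass_neg[OF supp])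
  also have "\<dots> = stat_mass ?b ?a (nat y)"
    by (rule stat_mass_stationary[OF step_mass_0[OF supp] suminf_step_mass[OF supp]])
  also have "\<dots> = rho_mass \<mu> \<mu>' y"
    using rho_mass_nonneg[OF supp', of \<mu> "nat y"] assms by simp
  finally show ?thesis .
qed

lemma stationary:
  "(\<integral>\<^sup>+x. rho_mass \<mu> \<mu>' x * kernel x {y} \<partial>count_space UNIV) = rho_mass \<mu> \<mu>' y"
proof (cases "y \<ge> 0")
  case False
  interpret R: oscillating_increments M "\<lambda>n \<omega>. - \<xi>' n \<omega>" "\<lambda>n \<omega>. - \<xi> n \<omega>"
    "map_pmf uminus \<mu>'" "map_pmf uminus \<mu>"
    by (rule reflect)
  show ?thesis
    using R.stationary_nonneg[of "-1 - y"] False nn_integral_count_space_int_reflect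
        [of "\<lambda>x. rho_mass (map_pmf uminus \<mu>') (map_pmf uminus \<mu>) x * R.kernel x {-1 - y}"]
    by (simp add: rho_mass_reflect kernel_reflect)
qed (rule stationary_nonneg)

lemma kernel_total: "kernel x UNIV = 1"
proof (cases "x \<le> -1")
  case False
  interpret R: oscillating_increments M "\<lambda>n \<omega>. - \<xi>' n \<omega>" "\<lambda>n \<omega>. - \<xi> n \<omega>"
    "map_pmf uminus \<mu>'" "map_pmf uminus \<mu>"
    by (rule reflect)
  have "R.kernel (-1 - x) UNIV = kernel x UNIV"
    by (subst kernel_eq_nn_integral, subst R.kernel_eq_nn_integral,
        subst nn_integral_count_space_int_reflect[symmetric]) (simp only: kernel_reflect)
  with R.kernel_neg_total[of "-1 - x"] False show ?thesis by simp
qed (rule kernel_neg_total)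

lemma kernel_cong:
  assumes "kernel x {y} \<noteq> 0"
  shows "[x = y] (mod supp_gcd \<mu> \<mu>')"
proof (cases "x \<le> -1")
  case True
  then show ?thesis
    using kernel_neg_dvd[OF True, of "supp_gcd \<mu> \<mu>'" y] assms
    by (simp add: cong_iff_dvd_diff dvd_diff_commute supp_gcd_dvd)
next
  case False
  interpret R: oscillating_increments M "\<lambda>n \<omega>. - \<xi>' n \<omega>" "\<lambda>n \<omega>. - \<xi> n \<omega>"
    "map_pmf uminus \<mu>'" "map_pmf uminus \<mu>"
    by (rule reflect)
  have "supp_gcd \<mu> \<mu>' dvd (-1 - y) - (-1 - x)"
    using False assms by (intro R.kernel_neg_dvd) (auto simp: supp_gcd_dvd kernel_reflect)
  then show ?thesis by (simp add: cong_iff_dvd_diff)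
qed

text \<open>Stationarity on all of the integers localises to the class: the kernel does not leave
  it, and no \<rho>-mass enters it from outside.\<close>

lemma invariant_restrict_cross_class:
  "invariant_measure kernel (restrict_space (rho \<mu> \<mu>') (cross_class \<mu> \<mu>' r))"
proof -
  let ?C = "cross_class \<mu> \<mu>' r" and ?\<rho> = "rho_mass \<mu> \<mu>'"
  let ?m = "restrict_space (rho \<mu> \<mu>') ?C"
  have C: "?C = {y. [y = r] (mod supp_gcd \<mu> \<mu>') \<and> ?\<rho> y \<noteq> 0}"
    by (rule cross_class_eq[OF supp supp'])
  have space: "space ?m = ?C" and sets: "sets ?m = Pow ?C"
    by (auto simp: rho_def space_restrict_space sets_restrict_space space_point_measure sets_point_measure)
  have int: "(\<integral>\<^sup>+x. f x \<partial>?m) = (\<integral>\<^sup>+x. ?\<rho> x * f x * indicator ?C x \<partial>count_space UNIV)" for f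
    by (simp add: nn_integral_restrict_space rho_def point_measure_def nn_integral_density mult.assoc)
  have em: "emeasure ?m A = (\<integral>\<^sup>+x. ?\<rho> x * indicator A x \<partial>count_space UNIV)" if "A \<subseteq> ?C" for A
    using that by (simp add: emeasure_restrict_space rho_def point_measure_def emeasure_density)
  \<comment> \<open>By stationarity a single term is at most the whole integral
    \<open>?\<rho> y\<close>, so a charged point never leads to an uncharged one.\<close>
  have closed: "y \<in> ?C" if "x \<in> ?C" "kernel x {y} \<noteq> 0" for x y
  proof -
    have "?\<rho> x * kernel x {y} \<le> ?\<rho> y"
      using nn_integral_ge_point[of x UNIV "\<lambda>x. ?\<rho> x * kernel x {y}"] by (simp add: stationary)
    with that have "?\<rho> y \<noteq> 0" by (auto simp: C)
    then show ?thesis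
      using that kernel_cong[OF that(2)] by (auto simp: C intro: cong_trans cong_sym)
  qed
  have "kernel x ?C = 1" if "x \<in> ?C" for x
  proof -
    have "kernel x ?C = (\<integral>\<^sup>+y. kernel x {y} \<partial>count_space UNIV)"
      unfolding kernel_eq_nn_integral[of x ?C] using closed[OF that]
      by (intro nn_integral_count_space_eq) auto
    then show ?thesis by (simp add: kernel_total flip: kernel_eq_nn_integral)
  qed
  moreover have "emeasure ?m {x} < \<infinity>" if "x \<in> ?C" for x
  proof -
    have "emeasure ?m {x} = ?\<rho> x"
      using that by (simp add: em nn_integral_count_space_indicator[symmetric] nn_integral_count_space_finite)
    also have "\<dots> < \<infinity>"
      using rho_mass_le_1[OF supp supp', of x] by (simp add: order.strict_trans1)
    finally show ?thesis .
  qed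
  moreover have "(\<integral>\<^sup>+x. kernel x A \<partial>?m) = emeasure ?m A" if "A \<subseteq> ?C" for A
  proof -
    \<comment> \<open>A point \<open>x\<close> outside \<open>?C\<close> has \<rho>-mass zero or
      lies in another residue class, from which \<open>y\<close> cannot be reached.\<close>
    have mass: "?\<rho> x * kernel x {y} * indicator ?C x = ?\<rho> x * kernel x {y}" if "y \<in> ?C" for x y
      using that kernel_cong[of x y]
      by (cases "x \<in> ?C") (auto simp: C intro: cong_trans)
    have "(\<integral>\<^sup>+x. kernel x A \<partial>?m)
        = (\<integral>\<^sup>+x. \<integral>\<^sup>+y. ?\<rho> x * kernel x {y} * indicator ?C x * indicator A y
          \<partial>count_space UNIV \<partial>count_space UNIV)"
      unfolding int kernel_eq_nn_integral[of _ A]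
      by (simp add: nn_integral_count_space_indicator ac_simps flip: nn_integral_cmult)
    also have "\<dots> = (\<integral>\<^sup>+y. \<integral>\<^sup>+x. ?\<rho> x * kernel x {y} * indicator ?C x * indicator A y
          \<partial>count_space UNIV \<partial>count_space UNIV)"
      by (rule nn_integral_count_space_commute)
    also have "\<dots> = (\<integral>\<^sup>+y. ?\<rho> y * indicator A y \<partial>count_space UNIV)"
    proof (intro nn_integral_cong)
      fix y
      show "(\<integral>\<^sup>+x. ?\<rho> x * kernel x {y} * indicator ?C x * indicator A y
          \<partial>count_space UNIV) = ?\<rho> y * indicator A y"
      proof (cases "y \<in> A")
        case True
        with that have "y \<in> ?C" by blast
        then show ?thesis using True by (simp add: mass stationary)
      qed simp
    qed
    also have "\<dots> = emeasure ?m A" by (rule em[OF that, symmetric])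
    finally show ?thesis .
  qed
  ultimately show ?thesis
    unfolding invariant_measure_def space sets by blast
qed

end

theorem theorem3p6:
  fixes \<mu> \<mu>' :: "int pmf"
    and M :: "'w measure"
    and \<xi> \<xi>' :: "nat \<Rightarrow> 'w \<Rightarrow> int"
    and x\<^sub>0 :: int
  assumes "set_pmf \<mu> \<subseteq> {1..}"
    and "set_pmf \<mu>' \<subseteq> {..-1}"
    and "prob_space M"
    and "prob_space.indep_vars M (\<lambda>_. count_space UNIV) (\<lambda>n \<omega>. (\<xi> n \<omega>, \<xi>' n \<omega>)) {1..}"
    and "\<And>n. n \<ge> 1 \<Longrightarrow> distr M (count_space UNIV) (\<lambda>\<omega>. (\<xi> n \<omega>, \<xi>' n \<omega>))
                       = distr M (count_space UNIV) (\<lambda>\<omega>. (\<xi> 1 \<omega>, \<xi>' 1 \<omega>))"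
    and "\<And>n. n \<ge> 1 \<Longrightarrow> distr M (count_space UNIV) (\<xi> n) = measure_pmf \<mu>"
    and "\<And>n. n \<ge> 1 \<Longrightarrow> distr M (count_space UNIV) (\<xi>' n) = measure_pmf \<mu>'"
  shows "invariant_measure (crossing_kernel M \<xi> \<xi>')
           (restrict_space (rho \<mu> \<mu>') (cross_class \<mu> \<mu>' (x\<^sub>0 mod supp_gcd \<mu> \<mu>')))"
proof -
  interpret prob_space M by fact
  interpret oscillating_increments M \<xi> \<xi>' \<mu> \<mu>'
    by unfold_locales (use assms in auto)
  show ?thesis by (rule invariant_restrict_cross_class)
qed

end
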